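(* Let $d\geq 1$ and let $k$ be an integer with $1\leq k\leq d^{1/4}/2$. Then any one-sided non-adaptive tester for $k$-monotonicity of functions $f\colon\{0,1\}^d\to\{0,1\}$ (for a suitable constant distance parameter $\varepsilon$) must make $(\Omega(d/k^2))^{k/4}$ queries.
   Context: The hypercube $\{0,1\}^d$ is ordered coordinatewise ($x\preceq y$ iff $x_i\leq y_i$ for all $i$). For a finite poset $\mathcal{D}$ and an integer $k\geq 0$, a function $f\colon\mathcal{D}\to\{0,1\}$ is $k$-monotone if there do not exist $x_1\preceq x_2\preceq\cdots\preceq x_{k+1}$ in $\mathcal{D}$ with $f(x_1)=1$ and $f(x_i)\neq f(x_{i+1})$ for all $i\in[k]$. The distance between $f,g\colon\mathcal{D}\to\{0,1\}$ is $\mathrm{dist}(f,g)=\Pr_{x}[f(x)\neq g(x)]$ for uniform $x\in\mathcal{D}$; the distance of $f$ to a property is the minimum distance to a function in it, and $f$ is $\varepsilon$-far if this distance is at least $\varepsilon$. A tester for a property with parameter $\varepsilon$ is a randomized algorithm with query access to $f$ that accepts with probability at least $2/3$ if $f$ has the property and rejects with probability at least $2/3$ if $f$ is $\varepsilon$-far from it. It is one-sided if it accepts every $f$ having the property with probability $1$, and non-adaptive if its queries depend only on its internal randomness and not on previous answers. *)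

theory Defs
  imports "HOL-Probability.Probability"
begin

text \<open>The hypercube {0,1}^d is represented as the power set of {..<d}:
  a point is the set of coordinates equal to 1; the coordinatewise order is inclusion.\<close>
definition cube :: "nat \<Rightarrow> nat set set" where
  "cube d = Pow {..<d}"

definition k_monotone :: "nat \<Rightarrow> nat \<Rightarrow> (nat set \<Rightarrow> bool) \<Rightarrow> bool" where
  "k_monotone d k f \<longleftrightarrow>
     \<not> (\<exists>xs :: nat set list. length xs = k + 1 \<and> set xs \<subseteq> cube d \<and>
          (\<forall>i<k. xs ! i \<subseteq> xs ! Suc i) \<and> f (xs ! 0) \<and>
          (\<forall>i<k. f (xs ! i) \<noteq> f (xs ! Suc i)))"

definition hdist :: "nat \<Rightarrow> (nat set \<Rightarrow> bool) \<Rightarrow> (nat set \<Rightarrow> bool) \<Rightarrow> real" where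
  "hdist d f g = real (card {x \<in> cube d. f x \<noteq> g x}) / 2 ^ d"

definition eps_far :: "nat \<Rightarrow> nat \<Rightarrow> real \<Rightarrow> (nat set \<Rightarrow> bool) \<Rightarrow> bool" where
  "eps_far d k eps f \<longleftrightarrow> (\<forall>g. k_monotone d k g \<longrightarrow> hdist d f g \<ge> eps)"

text \<open>A non-adaptive randomized tester: its internal randomness is a distribution over pairs
  (query list Q, decision rule D); it queries f on Q (independently of answers) and
  accepts iff D applied to the answers is True.\<close>
type_synonym na_tester = "(nat set list \<times> (bool list \<Rightarrow> bool)) pmf"

definition accept_prob :: "na_tester \<Rightarrow> (nat set \<Rightarrow> bool) \<Rightarrow> real" where
  "accept_prob T f = measure_pmf.prob T {(Q, D). D (map f Q)}"

definition one_sided_na_tester ::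
    "nat \<Rightarrow> nat \<Rightarrow> real \<Rightarrow> nat \<Rightarrow> na_tester \<Rightarrow> bool" where
  "one_sided_na_tester d k eps q T \<longleftrightarrow>
     (\<forall>(Q, D) \<in> set_pmf T. length Q \<le> q \<and> set Q \<subseteq> cube d) \<and>
     (\<forall>f. k_monotone d k f \<longrightarrow> accept_prob T f = 1) \<and>
     (\<forall>f. eps_far d k eps f \<longrightarrow> accept_prob T f \<le> 1 / 3)"

end

theory Submission
  imports Defs "HOL-Combinatorics.Multiset_Permutations"
begin

text \<open>A one-sided tester may reject only if the answers to its queries contain an alternating
  chain of length \<open>k + 1\<close>, since any other partial function extends to a \<open>k\<close>-monotone one.
  The hard inputs are \<open>x \<mapsto> |x \<inter> S| mod 2\<close> for a uniformly random set \<open>S\<close> of \<open>4 k\<^sup>2 + 1\<close> coordinates,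
  made constant outside the middle layers \<open>| |x| - d/2 | \<le> 2 \<surd>d\<close>. They are far from \<open>k\<close>-monotone:
  parity flips on all edges in the directions of \<open>S\<close>, whereas a \<open>k\<close>-monotone function flips at most
  \<open>k\<close> times on a maximal chain and hence, averaging over chains, only on a
  \<open>O(k / sqrt |S|)\<close> fraction of them. An alternating chain among the queries gives two queries
  \<open>x \<subseteq> y\<close> that differ in at most \<open>4 \<surd>d\<close> coordinates, at least \<open>k\<close> of them in \<open>S\<close>. For a fixed pair
  this has probability at most \<open>(60 k / \<surd>d)\<^sup>k\<close>, so a union bound over the \<open>q\<^sup>2\<close> pairs
  bounds \<open>q\<close> from below.\<close>

section \<open>Flips along chains and distance to parity\<close>

lemma chain_subset:
  fixes c :: "nat \<Rightarrow> 'a set"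
  assumes "\<And>i. i < k \<Longrightarrow> c i \<subseteq> c (Suc i)" and "i \<le> j" "j \<le> k"
  shows "c i \<subseteq> c j"
  using assms(2,3)
proof (induction rule: dec_induct)
  case (step n)
  then show ?case using assms(1)[of n] by auto
qed simp

definition flips :: "(nat \<Rightarrow> bool) \<Rightarrow> nat \<Rightarrow> nat" where
  "flips b m = (\<Sum>j<m. of_bool (b j \<noteq> b (Suc j)))"

lemma flips_0 [simp]: "flips b 0 = 0"
  and flips_Suc [simp]: "flips b (Suc m) = flips b m + of_bool (b m \<noteq> b (Suc m))"
  by (simp_all add: flips_def)

lemma flips_eq_card: "flips b m = card {j. j < m \<and> b j \<noteq> b (Suc j)}"
  by (simp add: flips_def flip: Collect_conj_eq) (simp add: lessThan_def Int_def)

lemma flips_mono: "m \<le> n \<Longrightarrow> flips b m \<le> flips b n"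
  by (rule lift_Suc_mono_le[of "flips b"]) auto

lemma odd_flips_iff: "odd (flips b m) \<longleftrightarrow> b m \<noteq> b 0"
  by (induction m) auto

text \<open>A discrete intermediate value theorem: each step raises the count by at most one, so no
  value is skipped.\<close>

lemma flips_intermediate: "i \<le> flips b m \<Longrightarrow> \<exists>j\<le>m. flips b j = i"
proof (induction m)
  case (Suc m)
  show ?case
  proof (cases "i \<le> flips b m")
    case True
    then show ?thesis using Suc.IH le_SucI by blast
  next
    case False
    then have "flips b (Suc m) = i" using Suc.prems by (cases "b m = b (Suc m)") auto
    then show ?thesis by blast
  qed
qed simp

text \<open>If there were more than \<open>k\<close> flips, each \<open>i \<le> k + 1\<close> would
  have a position \<open>\<phi> i\<close> reached after exactly \<open>i\<close> flips. By
  \<open>odd_flips_iff\<close> the values at these positions alternate, which yields a forbidden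
  chain.\<close>

lemma k_monotone_flips_le:
  assumes mono: "k_monotone d k g"
    and cube: "\<And>j. j \<le> m \<Longrightarrow> c j \<in> cube d"
    and chain: "\<And>j. j < m \<Longrightarrow> c j \<subseteq> c (Suc j)"
  shows "flips (\<lambda>j. g (c j)) m \<le> k"
proof (rule ccontr)
  define b where "b = (\<lambda>j. g (c j))"
  assume "\<not> flips (\<lambda>j. g (c j)) m \<le> k"
  then have "\<forall>i\<le>Suc k. \<exists>j\<le>m. flips b j = i"
    using flips_intermediate[of _ b m] by (force simp: b_def)
  then obtain \<phi> where \<phi>: "\<And>i. i \<le> Suc k \<Longrightarrow> \<phi> i \<le> m" "\<And>i. i \<le> Suc k \<Longrightarrow> flips b (\<phi> i) = i"
    by metis
  have \<phi>_mono: "\<phi> i \<le> \<phi> (Suc i)" if "i \<le> k" for i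
    using flips_mono[of "\<phi> (Suc i)" "\<phi> i" b] \<phi>(2)[of i] \<phi>(2)[of "Suc i"] that
    by (cases "\<phi> i \<le> \<phi> (Suc i)") auto
  have val: "b (\<phi> i) \<longleftrightarrow> b 0 \<noteq> odd i" if "i \<le> Suc k" for i
    using odd_flips_iff[of b "\<phi> i"] \<phi>(2)[OF that] by auto
  \<comment> \<open>There are k + 2 alternating positions, but a forbidden chain has k + 1 points
    and starts with True. If the first value is False, that position is skipped.\<close>
  define r :: nat where "r = of_bool (\<not> b 0)"
  have r: "r \<le> 1" "b 0 \<longleftrightarrow> even r" by (auto simp: r_def)
  define xs where "xs = map (\<lambda>i. c (\<phi> (i + r))) [0..<k + 1]"
  have nth: "xs ! i = c (\<phi> (i + r))" if "i \<le> k" for i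
    unfolding xs_def using that by (subst nth_map) (auto simp del: upt_Suc)
  have "set xs \<subseteq> cube d"
    unfolding xs_def using r(1) by (auto intro!: cube \<phi>(1) simp del: upt_Suc)
  moreover have "xs ! i \<subseteq> xs ! Suc i" if "i < k" for i
    using that r(1) chain_subset[of m c "\<phi> (i + r)" "\<phi> (Suc i + r)"] chain \<phi>_mono[of "i + r"] \<phi>(1)[of "Suc i + r"]
    by (simp add: nth)
  moreover have gval: "g (xs ! i) \<longleftrightarrow> even i" if "i \<le> k" for i
    using val[of "i + r"] r that by (auto simp: nth b_def)
  moreover have "length xs = k + 1" by (simp add: xs_def)
  ultimately have "\<exists>xs. length xs = k + 1 \<and> set xs \<subseteq> cube d \<and> (\<forall>i<k. xs ! i \<subseteq> xs ! Suc i) \<and>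
      g (xs ! 0) \<and> (\<forall>i<k. g (xs ! i) \<noteq> g (xs ! Suc i))"
    by (intro exI[of _ xs]) simp
  then show False using mono by (simp add: k_monotone_def)
qed

section \<open>Counting flipping edges of a cube by maximal chains\<close>

text \<open>A permutation of \<open>S\<close> encodes the maximal chain of its prefixes. An ordering
  of \<open>X\<close>, then \<open>i\<close>, then an ordering of the remaining elements gives a
  chain through the edge from \<open>X\<close> to \<open>insert i X\<close>.\<close>

lemma card_permutations_through_edge:
  assumes "finite S" "X \<subseteq> S" "i \<in> S - X"
  shows "fact (card X) * fact (card S - 1 - card X) \<le>
    card {xs \<in> permutations_of_set S. set (take (card X) xs) = X \<and> xs ! card X = i}"
    (is "_ \<le> card ?W")
proof -
  let ?R = "S - X - {i}"
  let ?P = "permutations_of_set X \<times> permutations_of_set ?R"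
  let ?h = "\<lambda>(a, b). a @ i # b"
  have fin: "finite X" "finite ?R" using assms finite_subset by auto
  have "card ?R = card S - 1 - card X"
    using assms fin by (simp add: card_Diff_subset)
  then have "fact (card X) * fact (card S - 1 - card X) = card ?P"
    using fin by (simp add: card_cartesian_product)
  also have "\<dots> = card (?h ` ?P)"
    by (rule card_image[symmetric], rule inj_onI)
      (auto simp: length_finite_permutations_of_set)
  also have "\<dots> \<le> card ?W"
  proof (rule card_mono)
    show "?h ` ?P \<subseteq> ?W"
    proof (rule image_subsetI)
      fix p assume "p \<in> ?P"
      then obtain a b where p: "p = (a, b)" "set a = X" "distinct a" "set b = ?R" "distinct b"
        by (auto simp: permutations_of_set_def)
      then have "length a = card X" using distinct_card by fastforce
      with p assms(2,3) show "?h p \<in> ?W" by (auto simp: permutations_of_set_def nth_append)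
    qed
  qed simp
  finally show ?thesis .
qed

text \<open>Counts the pairs of a flipping edge and a maximal chain through it.\<close>
lemma card_flip_edges_le:
  fixes S :: "'a set"
  assumes S: "finite S"
    and flips: "\<And>xs. xs \<in> permutations_of_set S \<Longrightarrow> flips (\<lambda>j. g (set (take j xs))) (card S) \<le> k"
  shows "card {(X, i). X \<subseteq> S \<and> i \<in> S - X \<and> g X \<noteq> g (insert i X)}
    \<le> k * card S * ((card S - 1) choose ((card S - 1) div 2))" 
proof (cases "S = {}")
  case True
  then show ?thesis by auto
next
  case False
  define n where "n = card S - 1"
  have n: "card S = Suc n" using False S by (simp add: n_def card_gt_0_iff)
  define E where "E = {(X, i). X \<subseteq> S \<and> i \<in> S - X \<and> g X \<noteq> g (insert i X)}"
  define P where "P = permutations_of_set S"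
  define through where "through = (\<lambda>(X :: 'a set, i) xs. set (take (card X) xs) = X \<and> xs ! card X = i)"
  have "E \<subseteq> Pow S \<times> S" by (auto simp: E_def)
  then have finE: "finite E" using S finite_subset by blast
  have finP: "finite P" by (simp add: P_def)
  have edge: "fact n \<le> card {xs \<in> P. through e xs} * (n choose (n div 2))" if "e \<in> E" for e
  proof -
    obtain X i where e: "e = (X, i)" "X \<subseteq> S" "i \<in> S - X" using \<open>e \<in> E\<close> by (auto simp: E_def)
    have "card X < card S" using e S by (intro psubset_card_mono) auto
    then have le: "card X \<le> n" using n by simp
    \<comment> \<open>The factorials combine to a binomial coefficient, which is largest in the
      middle. So every edge, whatever its level, lies on at least n! / (n choose n div 2)
      chains.\<close>
    have "fact n = fact (card X) * fact (n - card X) * (n choose card X)"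
      using binomial_fact_lemma[OF le] by (simp add: ac_simps)
    also have "\<dots> \<le> card {xs \<in> P. through e xs} * (n choose (n div 2))"
      using card_permutations_through_edge[OF S e(2,3)] binomial_maximum[of n "card X"]
      by (intro mult_mono) (auto simp: e(1) n through_def P_def)
    finally show ?thesis .
  qed
  \<comment> \<open>A chain contains one edge per level, the one between consecutive prefixes, so
    its flipping edges are indexed by its flips.\<close>
  have perm: "card {e \<in> E. through e xs} \<le> k" if xs: "xs \<in> P" for xs
  proof -
    let ?J = "{j. j < card S \<and> g (set (take j xs)) \<noteq> g (set (take (Suc j) xs))}"
    have len: "length xs = card S" "distinct xs"
      using xs by (auto simp: P_def length_finite_permutations_of_set permutations_of_set_def)
    have "{e \<in> E. through e xs} \<subseteq> (\<lambda>j. (set (take j xs), xs ! j)) ` ?J"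
    proof (rule subsetI)
      fix e assume "e \<in> {e \<in> E. through e xs}"
      then obtain X i where e: "e = (X, i)" and *: "X \<subseteq> S" "i \<in> S" "i \<notin> X" "g X \<noteq> g (insert i X)"
        "set (take (card X) xs) = X" "xs ! card X = i"
        by (auto simp: E_def through_def)
      have "card X < card S" using * S by (intro psubset_card_mono) auto
      then have "set (take (Suc (card X)) xs) = insert i X"
        using * len by (simp add: take_Suc_conv_app_nth)
      then have "card X \<in> ?J" using * \<open>card X < card S\<close> by simp
      then show "e \<in> (\<lambda>j. (set (take j xs), xs ! j)) ` ?J"
        using * e by (intro image_eqI[of _ _ "card X"]) auto
    qed
    then have "card {e \<in> E. through e xs} \<le> card ((\<lambda>j. (set (take j xs), xs ! j)) ` ?J)"
      by (intro card_mono) auto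
    also have "\<dots> \<le> card ?J" by (intro card_image_le) auto
    also have "\<dots> \<le> k" using flips xs by (simp add: flips_eq_card P_def)
    finally show ?thesis .
  qed
  have "card E * fact n \<le> (\<Sum>e\<in>E. card {xs \<in> P. through e xs} * (n choose (n div 2)))"
    using sum_mono[of E "\<lambda>_. fact n :: nat", OF edge] by simp
  also have "\<dots> = (\<Sum>e\<in>E. card {xs \<in> P. through e xs}) * (n choose (n div 2))"
    by (simp add: sum_distrib_right)
  also have "\<dots> = (\<Sum>xs\<in>P. card {e \<in> E. through e xs}) * (n choose (n div 2))"
    using finE finP by (subst sum_multicount_gen[of E P through "\<lambda>xs. card {e \<in> E. through e xs}"]) auto
  also have "\<dots> \<le> (\<Sum>xs\<in>P. k) * (n choose (n div 2))"
    by (intro mult_right_mono sum_mono perm) auto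
  also have "\<dots> = (k * card S * (n choose (n div 2))) * fact n"
    using S n by (simp add: P_def algebra_simps)
  finally show ?thesis by (simp add: n_def E_def)
qed

lemma card_cube_edges:
  assumes "finite S"
  shows "card {(X, i). X \<subseteq> S \<and> i \<in> S - X} = card S * 2 ^ (card S - 1)"
proof -
  have "{(X, i). X \<subseteq> S \<and> i \<in> S - X} = prod.swap ` (SIGMA i:S. Pow (S - {i}))"
    by force
  then have "card {(X, i). X \<subseteq> S \<and> i \<in> S - X} = card (SIGMA i:S. Pow (S - {i}))"
    by (simp add: card_image)
  also have "\<dots> = card S * 2 ^ (card S - 1)"
    using assms by (simp add: card_SigmaI card_Pow)
  finally show ?thesis .
qed

text \<open>Parity flips on every edge, so each edge on which g is constant has an endpoint
  where g differs from parity, and every point lies on \<open>card S\<close> edges.\<close>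
lemma card_parity_disagreement_ge:
  assumes S: "finite S" "S \<noteq> {}"
    and flips: "\<And>xs. xs \<in> permutations_of_set S \<Longrightarrow> flips (\<lambda>j. g (set (take j xs))) (card S) \<le> k"
  shows "2 ^ (card S - 1) \<le> card {X \<in> Pow S. g X \<noteq> odd (card X)}
    + k * ((card S - 1) choose ((card S - 1) div 2))" (is "_ \<le> card ?B + ?K")
proof -
  let ?A = "{(X, i). X \<subseteq> S \<and> i \<in> S - X}"
  let ?E = "{(X, i). X \<subseteq> S \<and> i \<in> S - X \<and> g X \<noteq> g (insert i X)}"
  \<comment> \<open>Each edge without a flip is charged to an endpoint in \<open>?B\<close>,
    together with its direction. This is injective: whether \<open>i\<close> belongs to the first
    component tells which endpoint was taken.\<close>
  let ?h = "\<lambda>(X, i). if X \<in> ?B then (X, i) else (insert i X, i)"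
  have "?A \<subseteq> Pow S \<times> S" by auto
  then have finA: "finite ?A" using S finite_subset by blast
  have "card (?A - ?E) = card (?h ` (?A - ?E))"
  proof (rule card_image[symmetric], rule inj_onI)
    fix e e' assume "e \<in> ?A - ?E" "e' \<in> ?A - ?E" "?h e = ?h e'"
    moreover obtain X i X' i' where "e = (X, i)" "e' = (X', i')" by (metis surj_pair)
    moreover have "insert i X = insert i X' \<longleftrightarrow> X = X'" if "i \<notin> X" "i \<notin> X'"
      using that by (rule insert_ident)
    ultimately show "e = e'" by (simp split: if_splits) blast+
  qed
  also have "\<dots> \<le> card (?B \<times> S)"
  proof (rule card_mono)
    show "?h ` (?A - ?E) \<subseteq> ?B \<times> S"
    proof (rule image_subsetI)
      fix e assume "e \<in> ?A - ?E"
      then obtain X i where *: "e = (X, i)" "X \<subseteq> S" "i \<in> S" "i \<notin> X" "g X = g (insert i X)"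
        by auto
      have "finite X" using * S finite_subset by blast
      then show "?h e \<in> ?B \<times> S" using * by auto
    qed
  qed (use S in auto)
  finally have 1: "card (?A - ?E) \<le> card ?B * card S" by (simp add: card_cartesian_product)
  have 2: "card ?E \<le> k * card S * ((card S - 1) choose ((card S - 1) div 2))"
    by (rule card_flip_edges_le[OF S(1) flips])
  have "?E \<subseteq> ?A" by auto
  then have "card ?A = card (?A - ?E) + card ?E"
    using finA finite_subset[of ?E ?A] card_mono[of ?A ?E] by (simp add: card_Diff_subset)
  then have "card S * 2 ^ (card S - 1) \<le> card S * (card ?B + ?K)"
    using 1 2 card_cube_edges[OF S(1)] by (simp add: algebra_simps)
  then show ?thesis using S by (simp add: card_gt_0_iff)
qed

section \<open>Distance of a \<open>k\<close>-monotone function from a parity\<close>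

text \<open>The bound 4^n / sqrt (2n + 1), squared to stay within the naturals. Consecutive central
  binomials have ratio 2 (2n + 1) / (n + 1), and the induction closes because (2n + 1) (2n + 3) <=
  (2n + 2)^2.\<close>

lemma central_binomial_sq_le: "((2 * n) choose n) ^ 2 * (2 * n + 1) \<le> 16 ^ n"
proof (induction n)
  case (Suc n)
  define C where "C = (2 * n) choose n"
  define C' where "C' = (2 * Suc n) choose Suc n"
  have "Suc n * C' = 2 * (2 * n + 1) * C"
  proof -
    have a: "Suc n * C' = (2 * n + 2) * ((2 * n + 1) choose n)"
      using Suc_times_binomial_eq[of "2 * n + 1" n] unfolding C'_def by (simp add: mult.commute)
    have b: "Suc n * ((2 * n + 1) choose n) = (2 * n + 1) * C"
      using binomial_absorb_comp[of "2*n+1" n] unfolding C_def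
      by simp
    have "Suc n * (Suc n * C') = Suc n * (2 * (2 * n + 1) * C)"
      unfolding a using b by (metis (no_types, lifting) add.commute mult.assoc mult.left_commute mult_2_right mult_Suc_right plus_1_eq_Suc one_add_one add_mult_distrib2 mult.right_neutral)
    then show ?thesis by (simp only: mult_cancel1) simp
  qed
  then have eq: "(Suc n * C')\<^sup>2 = (2 * (2 * n + 1) * C)\<^sup>2" by (rule arg_cong)
  have "(Suc n)\<^sup>2 * (C'\<^sup>2 * (2 * n + 3)) = (Suc n * C')\<^sup>2 * (2 * n + 3)"
    by (simp only: power_mult_distrib mult.assoc)
  also have "\<dots> = 4 * (2 * n + 3) * (2 * n + 1) * (C\<^sup>2 * (2 * n + 1))"
    unfolding eq by algebra
  also have "\<dots> \<le> 4 * (2 * n + 3) * (2 * n + 1) * 16 ^ n"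
    using Suc.IH by (simp add: C_def)
  also have "\<dots> \<le> (16 * (Suc n)\<^sup>2) * 16 ^ n"
    by (intro mult_right_mono) (auto simp: power2_eq_square algebra_simps)
  finally have "C'\<^sup>2 * (2 * n + 3) \<le> 16 ^ Suc n" by simp
  moreover have "2 * Suc n + 1 = 2 * n + 3" by simp
  ultimately show ?case unfolding C'_def by (simp only:)
qed simp

text \<open>Fixing the part \<open>z\<close> of a point outside \<open>S\<close> leaves a subcube in
  the directions of \<open>S\<close>, whose chains are chains of the whole cube. The flip term of
  \<open>card_parity_disagreement_ge\<close> is then at most half of
  \<open>2 ^ (4 * k\<^sup>2)\<close>, so at least a quarter of every subcube disagrees with
  parity.\<close>

lemma k_monotone_far_from_parity:
  assumes S: "S \<subseteq> {..<d}" "card S = 4 * k\<^sup>2 + 1" and g: "k_monotone d k g"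
  shows "2 ^ d \<le> 4 * card {x \<in> cube d. g x \<noteq> odd (card (x \<inter> S))}" (is "_ \<le> 4 * card ?B")
proof -
  have finS: "finite S" and S0: "S \<noteq> {}" using S finite_subset by auto
  define Z where "Z = {..<d} - S"
  define b where "b z = {Y \<in> Pow S. g (z \<union> Y) \<noteq> odd (card Y)}" for z
  have sd: "card S \<le> d" using S(1) card_mono[of "{..<d}" S] by simp
  have finb: "finite (b z)" for z using finS by (simp add: b_def)
  have b: "2 ^ card S \<le> 4 * card (b z)" if "z \<in> Pow Z" for z
  proof -
    have "flips (\<lambda>j. g (z \<union> set (take j xs))) (card S) \<le> k" if "xs \<in> permutations_of_set S" for xs
    proof (rule k_monotone_flips_le[OF g])
      show "z \<union> set (take j xs) \<in> cube d" for j
        using \<open>z \<in> Pow Z\<close> S(1) that set_take_subset[of j xs]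
        by (auto simp: cube_def Z_def permutations_of_set_def)
      show "z \<union> set (take j xs) \<subseteq> z \<union> set (take (Suc j) xs)" for j
        using set_take_subset_set_take[of j "Suc j" xs] by auto
    qed
    from card_parity_disagreement_ge[OF finS S0, of "\<lambda>Y. g (z \<union> Y)", OF this]
    have 1: "2 ^ (4 * k\<^sup>2) \<le> card (b z) + k * ((4 * k\<^sup>2) choose (2 * k\<^sup>2))"
      using S(2) by (simp add: b_def)
    \<comment> \<open>Here the size of \<open>S\<close> matters: (2k)^2 is at most the factor 4k^2 +
      1 in the central binomial bound.\<close>
    have "(2 * k * ((4 * k\<^sup>2) choose (2 * k\<^sup>2)))\<^sup>2 \<le> ((4 * k\<^sup>2) choose (2 * k\<^sup>2))\<^sup>2 * (4 * k\<^sup>2 + 1)"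
      by (simp add: power_mult_distrib)
    also have "\<dots> \<le> 16 ^ (2 * k\<^sup>2)"
      using central_binomial_sq_le[of "2 * k\<^sup>2"] by simp
    also have "(16::nat) ^ (2 * k\<^sup>2) = (2 ^ 4) ^ (2 * k\<^sup>2)" by simp
    also have "\<dots> = (2 ^ (4 * k\<^sup>2))\<^sup>2"
      by (simp only: power_mult[symmetric] mult.commute mult.left_commute)
    finally have "2 * k * ((4 * k\<^sup>2) choose (2 * k\<^sup>2)) \<le> 2 ^ (4 * k\<^sup>2)"
      by (simp add: power2_nat_le_eq_le)
    then show ?thesis using 1 S(2) by simp
  qed
  have cZ: "card (Pow Z) = 2 ^ (d - card S)"
    using S(1) finS by (simp add: Z_def card_Pow card_Diff_subset)
  have "2 ^ d = (\<Sum>z\<in>Pow Z. (2::nat) ^ card S)"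
    using cZ sd by (simp flip: power_add)
  also have "\<dots> \<le> (\<Sum>z\<in>Pow Z. 4 * card (b z))" by (intro sum_mono b)
  also have "\<dots> = 4 * card (Sigma (Pow Z) b)"
    using finb by (simp add: sum_distrib_left Z_def)
  also have "card (Sigma (Pow Z) b) = card ((\<lambda>(z, Y). z \<union> Y) ` Sigma (Pow Z) b)"
  proof (rule card_image[symmetric], rule inj_onI, clarify)
    fix z Y z' Y' assume *: "z \<subseteq> Z" "z' \<subseteq> Z" "Y \<in> b z" "Y' \<in> b z'" "z \<union> Y = z' \<union> Y'"
    then have "(z \<union> Y) - S = z" "(z' \<union> Y') - S = z'" "(z \<union> Y) \<inter> S = Y" "(z' \<union> Y') \<inter> S = Y'"
      by (auto simp: Z_def b_def)
    then show "z = z' \<and> Y = Y'" using * by metis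
  qed
  also have "\<dots> \<le> card ?B"
  proof (rule card_mono)
    show "(\<lambda>(z, Y). z \<union> Y) ` Sigma (Pow Z) b \<subseteq> ?B"
    proof clarify
      fix z Y assume *: "z \<subseteq> Z" "Y \<in> b z"
      then have "(z \<union> Y) \<inter> S = Y" by (auto simp: Z_def b_def)
      moreover have "z \<union> Y \<in> cube d" using * S(1) by (auto simp: Z_def b_def cube_def)
      ultimately show "z \<union> Y \<in> cube d \<and> g (z \<union> Y) \<noteq> odd (card ((z \<union> Y) \<inter> S))"
        using * by (auto simp: b_def)
    qed
  qed (simp add: cube_def)
  finally show ?thesis by simp
qed

section \<open>Truncated parities\<close>

text \<open>The squared form avoids square roots and fits the variance computation below.\<close>

definition middle :: "nat \<Rightarrow> nat set \<Rightarrow> bool" where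
  "middle d x \<longleftrightarrow> (2 * real (card x) - real d)\<^sup>2 \<le> 16 * real d"

text \<open>The value above the middle layers is chosen so that an alternating chain
  of \<open>k + 1\<close> points starting with True cannot end there.\<close>
definition truncated_parity :: "nat \<Rightarrow> nat \<Rightarrow> nat set \<Rightarrow> nat set \<Rightarrow> bool" where
  "truncated_parity d k S x \<longleftrightarrow>
     (if middle d x then odd (card (x \<inter> S)) else d < 2 * card x \<and> odd k)"

text \<open>The variance of a sum of independent fair signs, one per element. A new element splits
  each deviation u into u - 1 and u + 1, whose squares sum to 2 u^2 + 2.\<close>

lemma sum_Pow_deviation_sq:
  "finite A \<Longrightarrow> (\<Sum>x\<in>Pow A. (2 * real (card x) - real (card A))\<^sup>2) = real (card A) * 2 ^ card A"
proof (induction A rule: finite_induct)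
  case (insert a A)
  define u where "u x = 2 * real (card x) - real (card A)" for x :: "'a set"
  have fin: "finite x" "a \<notin> x" if "x \<in> Pow A" for x
    using that insert.hyps finite_subset by auto
  have inj: "inj_on (Set.insert a) (Pow A)"
    using insert.hyps by (auto simp: inj_on_def)
  have "(\<Sum>x\<in>Pow (insert a A). (2 * real (card x) - real (card (insert a A)))\<^sup>2)
      = (\<Sum>x\<in>Pow A. (2 * real (card x) - real (card (insert a A)))\<^sup>2)
        + (\<Sum>x\<in>Pow A. (2 * real (card (insert a x)) - real (card (insert a A)))\<^sup>2)"
    unfolding Pow_insert using insert.hyps inj
    by (subst sum.union_disjoint) (auto simp: sum.reindex)
  also have "\<dots> = (\<Sum>x\<in>Pow A. (u x - 1)\<^sup>2 + (u x + 1)\<^sup>2)"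
    unfolding sum.distrib[symmetric]
    by (intro sum.cong refl) (simp add: fin insert.hyps u_def algebra_simps)
  also have "\<dots> = (\<Sum>x\<in>Pow A. 2 * (u x)\<^sup>2 + 2)"
    by (intro sum.cong refl) (simp add: power2_eq_square algebra_simps)
  also have "\<dots> = 2 * (real (card A) * 2 ^ card A) + 2 * 2 ^ card A"
    using insert.IH insert.hyps by (simp add: sum.distrib sum_distrib_left[symmetric] u_def card_Pow)
  also have "\<dots> = real (card (insert a A)) * 2 ^ card (insert a A)"
    using insert.hyps by (simp add: algebra_simps)
  finally show ?case .
qed simp

text \<open>Chebyshev's inequality with variance d and threshold 16 d.\<close>

lemma card_not_middle_le:
  assumes "d \<ge> 1"
  shows "16 * card {x \<in> cube d. \<not> middle d x} \<le> 2 ^ d" (is "16 * card ?U \<le> _")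
proof -
  have fin: "finite (cube d)" by (simp add: cube_def)
  have "real d * (16 * real (card ?U)) = (\<Sum>x\<in>?U. 16 * real d)"
    by simp
  also have "\<dots> \<le> (\<Sum>x\<in>?U. (2 * real (card x) - real d)\<^sup>2)"
    by (intro sum_mono) (auto simp: middle_def)
  also have "\<dots> \<le> (\<Sum>x\<in>cube d. (2 * real (card x) - real d)\<^sup>2)"
    using fin by (intro sum_mono2) auto
  also have "\<dots> = real d * 2 ^ d"
    using sum_Pow_deviation_sq[of "{..<d}"] by (simp add: cube_def)
  finally have "16 * real (card ?U) \<le> 2 ^ d"
    using assms by simp
  then show ?thesis
    by (metis (mono_tags, lifting) of_nat_le_iff of_nat_mult of_nat_numeral of_nat_power)
qed

text \<open>The full parity is at distance at least 1/4 from \<open>g\<close>, and truncation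
  changes at most 1/16 of the points, which leaves 3/16 >= 1/8.\<close>

lemma eps_far_truncated_parity:
  assumes "d \<ge> 1" and S: "S \<subseteq> {..<d}" "card S = 4 * k\<^sup>2 + 1"
  shows "eps_far d k (1 / 8) (truncated_parity d k S)"
  unfolding eps_far_def
proof (intro allI impI)
  fix g assume g: "k_monotone d k g"
  let ?N = "{x \<in> cube d. truncated_parity d k S x \<noteq> g x}"
  let ?U = "{x \<in> cube d. \<not> middle d x}"
  let ?B = "{x \<in> cube d. g x \<noteq> odd (card (x \<inter> S))}"
  have "?B \<subseteq> ?N \<union> ?U" by (auto simp: truncated_parity_def)
  then have "card ?B \<le> card (?N \<union> ?U)" by (intro card_mono) (auto simp: cube_def)
  also have "\<dots> \<le> card ?N + card ?U" by (rule card_Un_le)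
  finally have "2 ^ d \<le> 8 * card ?N"
    using k_monotone_far_from_parity[OF S g] card_not_middle_le[OF assms(1)] by linarith
  then have "(2::real) ^ d \<le> 8 * real (card ?N)"
    by (metis (mono_tags, lifting) of_nat_le_iff of_nat_mult of_nat_numeral of_nat_power)
  then show "hdist d (truncated_parity d k S) g \<ge> 1 / 8"
    by (simp add: hdist_def field_simps)
qed

section \<open>Alternating chains\<close>

text \<open>Tying values to the parity of the index makes every prefix a chain of the same kind, and
  the length alone decides which value may be appended. The empty list qualifies.\<close>

definition alternating_chain :: "'a set set \<Rightarrow> ('a set \<Rightarrow> bool) \<Rightarrow> 'a set list \<Rightarrow> bool" where
  "alternating_chain Q f xs \<longleftrightarrow> set xs \<subseteq> Q \<and>
     (\<forall>i. Suc i < length xs \<longrightarrow> xs ! i \<subseteq> xs ! Suc i) \<and>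
     (\<forall>i<length xs. f (xs ! i) \<longleftrightarrow> even i)"

lemma alternating_chain_snoc:
  assumes "alternating_chain Q f xs" "\<forall>y\<in>set xs. y \<subseteq> x" "x \<in> Q" "f x \<longleftrightarrow> even (length xs)"
  shows "alternating_chain Q f (xs @ [x])"
  unfolding alternating_chain_def
proof (intro conjI allI impI)
  fix i assume "Suc i < length (xs @ [x])"
  then consider "Suc i < length xs" | "Suc i = length xs" by fastforce
  then show "(xs @ [x]) ! i \<subseteq> (xs @ [x]) ! Suc i"
    using assms(1,2) by cases (auto simp: alternating_chain_def nth_append)
next
  fix i assume "i < length (xs @ [x])"
  then consider "i < length xs" | "i = length xs" by fastforce
  then show "f ((xs @ [x]) ! i) \<longleftrightarrow> even i"
    using assms(1,4) by cases (auto simp: alternating_chain_def nth_append)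
qed (use assms in \<open>auto simp: alternating_chain_def\<close>)

lemma alternating_chain_take:
  "alternating_chain Q f xs \<Longrightarrow> alternating_chain Q f (take n xs)"
  using subset_trans[OF set_take_subset[of n xs], of Q] by (simp add: alternating_chain_def)

text \<open>The extension at x is the parity of the length of a longest alternating chain below x.\<close>
lemma k_monotone_extension:
  assumes no: "\<And>xs. alternating_chain Q f xs \<Longrightarrow> length xs \<noteq> k + 1"
  shows "\<exists>g. k_monotone d k g \<and> (\<forall>x\<in>Q. g x = f x)"
proof -
  have short: "length xs \<le> k" if "alternating_chain Q f xs" for xs
    using no[OF alternating_chain_take[OF that, of "k + 1"]] by (cases "length xs \<le> k") auto
  define L where "L x = {length xs |xs. alternating_chain Q f xs \<and> (\<forall>y\<in>set xs. y \<subseteq> x)}" for x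
  define r where "r x = Max (L x)" for x
  have "L x \<subseteq> {..k}" for x using short by (auto simp: L_def)
  then have fin: "finite (L x)" for x using finite_subset by blast
  have "0 \<in> L x" for x
    unfolding L_def by (auto simp: alternating_chain_def intro!: exI[of _ "[]"])
  then have r_in: "r x \<in> L x" for x
    unfolding r_def using fin Max_in by blast
  then have r_le: "r x \<le> k" for x using \<open>\<And>x. L x \<subseteq> {..k}\<close> by blast
  have r_mono: "r x \<le> r y" if "x \<subseteq> y" for x y
    unfolding r_def
  proof (rule Max_mono)
    show "L x \<subseteq> L y" using that by (fastforce simp: L_def)
    show "L x \<noteq> {}" using r_in by blast
  qed (rule fin)
  \<comment> \<open>Otherwise \<open>x\<close> itself could be appended to a longest chain below
    it.\<close>
  have val: "odd (r x) = f x" if "x \<in> Q" for x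
  proof (rule ccontr)
    assume neq: "odd (r x) \<noteq> f x"
    obtain xs where xs: "r x = length xs" "alternating_chain Q f xs" "\<forall>y\<in>set xs. y \<subseteq> x"
      using r_in[of x] by (auto simp: L_def)
    have "alternating_chain Q f (xs @ [x])"
      using xs that neq by (intro alternating_chain_snoc) auto
    then have "Suc (r x) \<in> L x"
      using xs unfolding L_def by (auto intro!: exI[of _ "xs @ [x]"])
    then have "Suc (r x) \<le> r x" using fin[of x] by (simp add: r_def)
    then show False by simp
  qed
  have "k_monotone d k (\<lambda>x. odd (r x))"
    unfolding k_monotone_def
  proof clarify
    fix ys assume ys: "\<forall>i<k. ys ! i \<subseteq> ys ! Suc i" "odd (r (ys ! 0))"
      "\<forall>i<k. odd (r (ys ! i)) \<noteq> odd (r (ys ! Suc i))"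
    \<comment> \<open>Along \<open>ys\<close> the rank \<open>r\<close> never decreases and changes
      parity at each step, so it strictly increases from a value of at least 1. It would exceed its
      bound \<open>k\<close> at the last point.\<close>
    have "i \<le> k \<Longrightarrow> i < r (ys ! i)" for i
    proof (induction i)
      case 0
      then show ?case using ys(2) by (simp add: odd_pos)
    next
      case (Suc i)
      then have "r (ys ! i) \<le> r (ys ! Suc i)" "r (ys ! i) \<noteq> r (ys ! Suc i)"
        using ys r_mono by (auto simp: Suc_le_eq)
      then show ?case using Suc by simp
    qed
    then show False using r_le[of "ys ! k"] by fastforce
  qed
  then show ?thesis using val by blast
qed

section \<open>From a rejection to two separated queries\<close>

text \<open>Without such a chain the answers are also those of a \<open>k\<close>-monotone
  \<open>g\<close>. Acceptance of \<open>g\<close> with probability 1 forces every pair in the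
  support to accept them.\<close>

lemma rejection_imp_alternating_chain:
  assumes T: "one_sided_na_tester d k eps q T" and QD: "(Q, D) \<in> set_pmf T" "\<not> D (map f Q)"
  shows "\<exists>xs. alternating_chain (set Q) f xs \<and> length xs = k + 1"
proof (rule ccontr)
  assume "\<not> ?thesis"
  then obtain g where g: "k_monotone d k g" "\<forall>x\<in>set Q. g x = f x"
    using k_monotone_extension[of "set Q" f k d] by blast
  then have "map g Q = map f Q" by simp
  have "accept_prob T g = 1" using T g(1) by (simp add: one_sided_na_tester_def)
  then have "AE p in measure_pmf T. p \<in> {(Q, D). D (map g Q)}"
    unfolding accept_prob_def by (subst (asm) measure_pmf.prob_eq_1) auto
  then have "D (map g Q)" using QD(1) by (auto simp: AE_measure_pmf_iff)
  then show False using QD(2) \<open>map g Q = map f Q\<close> by simp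
qed

text \<open>The event implied by a rejection. It involves only the queries and \<open>S\<close>, not
  the decision rule.\<close>

definition separates :: "nat \<Rightarrow> nat \<Rightarrow> nat set set \<Rightarrow> nat set \<Rightarrow> bool" where
  "separates d k Q S \<longleftrightarrow>
     (\<exists>x\<in>Q. \<exists>y\<in>Q. x \<subseteq> y \<and> middle d x \<and> middle d y \<and> k \<le> card ((y - x) \<inter> S))"

text \<open>The chain stays in the middle layers, where each change of value changes the parity of
  the intersection with \<open>S\<close>. That intersection therefore grows by at least one element
  in each of the \<open>k\<close> steps.\<close>

lemma alternating_chain_truncated_parity:
  assumes Q: "Q \<subseteq> cube d" and xs: "alternating_chain Q (truncated_parity d k S) xs" "length xs = k + 1"
  shows "separates d k Q S"
proof -
  have inQ: "xs ! i \<in> Q" if "i \<le> k" for i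
    using that xs by (auto simp: alternating_chain_def)
  then have fin: "finite (xs ! i)" if "i \<le> k" for i
    using that Q finite_subset[of "xs ! i" "{..<d}"] by (auto simp: cube_def)
  have sub: "xs ! i \<subseteq> xs ! j" if "i \<le> j" "j \<le> k" for i j
    using chain_subset[of k "(!) xs" i j] xs that by (auto simp: alternating_chain_def)
  have val: "truncated_parity d k S (xs ! i) \<longleftrightarrow> even i" if "i \<le> k" for i
    using xs that by (simp add: alternating_chain_def)
  have card_le: "card (xs ! i) \<le> card (xs ! j)" if "i \<le> j" "j \<le> k" for i j
    using that by (intro card_mono fin sub) auto
  have below: "(2 * real b - real d)\<^sup>2 \<le> (2 * real a - real d)\<^sup>2"
    if "a \<le> b" "2 * b \<le> d" for a b :: nat
    using that by (subst (1 2) power2_commute) (intro power_mono, auto)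
  have above: "(2 * real a - real d)\<^sup>2 \<le> (2 * real b - real d)\<^sup>2"
    if "a \<le> b" "d < 2 * a" for a b :: nat
    using that by (intro power_mono) auto
  have mid: "middle d (xs ! i)" if i: "i \<le> k" for i
  proof (rule ccontr)
    assume nm: "\<not> middle d (xs ! i)"
    show False
    proof (cases "d < 2 * card (xs ! i)")
      \<comment> \<open>Above the middle the chain cannot return, so its last point has value
        \<open>odd k\<close>, whereas index \<open>k\<close> demands \<open>even k\<close>.\<close>
      case True
      have "card (xs ! i) \<le> card (xs ! k)" using i by (intro card_le) auto
      then have "\<not> middle d (xs ! k)" "d < 2 * card (xs ! k)"
        using above[OF _ True, of "card (xs ! k)"] nm True unfolding middle_def by linarith+
      then show False using val[of k] by (simp add: truncated_parity_def)
    next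
      \<comment> \<open>Symmetrically, the first point would lie below the middle and have value
        False, whereas index 0 demands True.\<close>
      case False
      have "card (xs ! 0) \<le> card (xs ! i)" using i by (intro card_le) auto
      then have "\<not> middle d (xs ! 0)" "\<not> d < 2 * card (xs ! 0)"
        using below[of "card (xs ! 0)" "card (xs ! i)"] nm False unfolding middle_def by linarith+
      then show False using val[of 0] by (simp add: truncated_parity_def)
    qed
  qed
  have "card (xs ! 0 \<inter> S) + i \<le> card (xs ! i \<inter> S)" if "i \<le> k" for i
    using that
  proof (induction i)
    case (Suc i)
    have "card (xs ! i \<inter> S) \<noteq> card (xs ! Suc i \<inter> S)"
      using val[of i] val[of "Suc i"] mid Suc.prems by (auto simp: truncated_parity_def)
    moreover have "card (xs ! i \<inter> S) \<le> card (xs ! Suc i \<inter> S)"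
      using sub[of i "Suc i"] fin[of "Suc i"] Suc.prems by (intro card_mono) auto
    ultimately show ?case using Suc by simp
  qed simp
  from this[of k] have "card (xs ! 0 \<inter> S) + k \<le> card (xs ! k \<inter> S)" by simp
  moreover have "card (xs ! k \<inter> S) - card (xs ! 0 \<inter> S) \<le> card ((xs ! k - xs ! 0) \<inter> S)"
    unfolding Diff_Int_distrib2 using fin[of 0] by (intro diff_card_le_card_Diff) auto
  ultimately have "k \<le> card ((xs ! k - xs ! 0) \<inter> S)" by linarith
  then show ?thesis
    unfolding separates_def using inQ[of 0] inQ[of k] sub[of 0 k] mid by blast
qed

section \<open>Random coordinate sets\<close>

text \<open>Removing \<open>K\<close> maps these sets injectively to subsets of
  \<open>A - K\<close>. For \<open>s < card K\<close> the left side is 0, while truncated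
  subtraction makes the right side 1.\<close>

lemma card_supersets_le:
  assumes "finite A" "K \<subseteq> A"
  shows "card {S. S \<subseteq> A \<and> card S = s \<and> K \<subseteq> S} \<le> (card A - card K) choose (s - card K)"
proof -
  let ?T = "{T. T \<subseteq> A - K \<and> card T = s - card K}"
  have finK: "finite K" using assms finite_subset by blast
  have "{S. S \<subseteq> A \<and> card S = s \<and> K \<subseteq> S} \<subseteq> (\<lambda>T. T \<union> K) ` ?T"
  proof clarify
    fix S assume "S \<subseteq> A" "K \<subseteq> S" "s = card S"
    then show "S \<in> (\<lambda>T. T \<union> K) ` {T. T \<subseteq> A - K \<and> card T = card S - card K}"
      using finK by (intro image_eqI[of _ _ "S - K"]) (auto simp: card_Diff_subset)
  qed
  then have "card {S. S \<subseteq> A \<and> card S = s \<and> K \<subseteq> S} \<le> card ?T"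
    using assms by (intro surj_card_le) auto
  also have "\<dots> = (card A - card K) choose (s - card K)"
    using assms finK n_subsets[of "A - K" "s - card K"] by (simp add: card_Diff_subset)
  finally show ?thesis .
qed

text \<open>A union bound over the \<open>k\<close>-subsets of \<open>V\<close> that
  \<open>S\<close> may contain.\<close>

lemma card_large_intersection_le:
  assumes A: "finite A" "V \<subseteq> A"
  shows "card {S. S \<subseteq> A \<and> card S = s \<and> k \<le> card (V \<inter> S)}
    \<le> (card V choose k) * ((card A - k) choose (s - k))"
proof -
  have finV: "finite V" using A finite_subset by blast
  let ?Ks = "{K. K \<subseteq> V \<and> card K = k}"
  let ?F = "\<lambda>K. {S. S \<subseteq> A \<and> card S = s \<and> K \<subseteq> S}"
  have finF: "finite (?F K)" for K using A by simp
  have finK: "finite ?Ks" using finV by simp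
  have "{S. S \<subseteq> A \<and> card S = s \<and> k \<le> card (V \<inter> S)} \<subseteq> (\<Union>K\<in>?Ks. ?F K)"
  proof clarify
    fix S assume S: "S \<subseteq> A" "s = card S" "k \<le> card (V \<inter> S)"
    obtain K where "K \<subseteq> V \<inter> S" "card K = k"
      using obtain_subset_with_card_n[OF S(3)] by metis
    then show "S \<in> (\<Union>K\<in>?Ks. {S'. S' \<subseteq> A \<and> card S' = card S \<and> K \<subseteq> S'})"
      using S by blast
  qed
  then have "card {S. S \<subseteq> A \<and> card S = s \<and> k \<le> card (V \<inter> S)} \<le> card (\<Union>K\<in>?Ks. ?F K)"
    using finK finF by (intro card_mono) blast+
  also have "\<dots> \<le> (\<Sum>K\<in>?Ks. card (?F K))"
    by (rule card_UN_le[OF finK])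
  also have "\<dots> \<le> (\<Sum>K\<in>?Ks. (card A - k) choose (s - k))"
    using A card_supersets_le[OF A(1)] by (intro sum_mono) force
  also have "\<dots> = (card V choose k) * ((card A - k) choose (s - k))"
    using n_subsets[OF finV, of k] by simp
  finally show ?thesis .
qed

text \<open>The ratio of the two binomials is at most (m/d)^k, because each factor satisfies (m - i)
  / (d - i) <= m/d. Denominators are cleared to stay in the naturals.\<close>

lemma choose_times_power_mono:
  fixes m d :: nat
  assumes "m \<le> d"
  shows "(m choose k) * d ^ k \<le> (d choose k) * m ^ k"
proof (induction k)
  case (Suc k)
  have step: "Suc k * (n choose Suc k) = (n choose k) * (n - k)" for n
    by (metis binomial_absorb_comp binomial_absorption mult.commute)
  have md: "(m - k) * d \<le> (d - k) * m"
    unfolding diff_mult_distrib using mult_le_mono2[OF assms, of k]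
    by (simp only: mult.commute[of d m] mult.commute[of _ k] diff_le_mono2)
  have "Suc k * ((m choose Suc k) * d ^ Suc k) = (Suc k * (m choose Suc k)) * d ^ Suc k"
    by (simp only: mult.assoc)
  also have "\<dots> = ((m choose k) * d ^ k) * ((m - k) * d)"
    unfolding step by (simp add: algebra_simps)
  also have "\<dots> \<le> ((d choose k) * m ^ k) * ((d - k) * m)"
    by (intro mult_mono Suc.IH md) auto
  also have "\<dots> = (Suc k * (d choose Suc k)) * m ^ Suc k"
    unfolding step by (simp add: algebra_simps)
  also have "\<dots> = Suc k * ((d choose Suc k) * m ^ Suc k)"
    by (simp only: mult.assoc)
  finally show ?case by (simp only: mult_le_cancel1)
qed simp

text \<open>A weak Stirling bound: the induction step costs a factor (1 + 1/k)^k <= e <= 3.\<close>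

lemma power_self_le_fact: "real k ^ k \<le> 3 ^ k * fact k"
proof (induction k)
  case (Suc k)
  show ?case
  proof (cases "k = 0")
    case False
    have "(1 + 1 / real k) ^ k \<le> exp (1 / real k) ^ k"
      by (intro power_mono) (auto simp: exp_ge_add_one_self)
    also have "\<dots> = exp 1" using False by (simp flip: exp_of_nat_mult)
    also have "\<dots> \<le> 3" by (rule exp_le)
    finally have "real k ^ k * (1 + 1 / real k) ^ k \<le> real k ^ k * 3"
      by (intro mult_left_mono) auto
    also have "real k ^ k * (1 + 1 / real k) ^ k = real (Suc k) ^ k"
      using False by (simp flip: power_mult_distrib add: field_simps)
    finally have "real (Suc k) ^ k \<le> 3 * (3 ^ k * fact k)" using Suc.IH by linarith
    then have "real (Suc k) * real (Suc k) ^ k \<le> real (Suc k) * (3 * (3 ^ k * fact k))"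
      by (intro mult_left_mono) auto
    then show ?thesis by (simp add: algebra_simps)
  qed simp
qed simp

lemma middle_card_Diff_le:
  assumes "finite y" "x \<subseteq> y" "middle d x" "middle d y"
  shows "real (card (y - x)) \<le> 4 * sqrt (real d)"
proof -
  have "\<bar>2 * real (card z) - real d\<bar> \<le> 4 * sqrt (real d)" if "middle d z" for z
  proof -
    have "sqrt ((2 * real (card z) - real d)\<^sup>2) \<le> sqrt (16 * real d)"
      using that unfolding middle_def by (rule real_sqrt_le_mono)
    then show ?thesis by (simp add: real_sqrt_mult)
  qed
  from this[OF assms(3)] this[OF assms(4)] show ?thesis
    using assms(1,2) card_mono[OF assms(1,2)] finite_subset[OF assms(2,1)]
    by (simp add: card_Diff_subset of_nat_diff)
qed

text \<open>Guarantees that sets \<open>S\<close> of the required size exist. With t = sqrt d >= 4,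
  the size is at most 2 t <= t^2.\<close>

lemma block_size_le:
  assumes "k \<ge> 1" "4 * real k ^ 2 \<le> sqrt (real d)"
  shows "4 * k\<^sup>2 + 1 \<le> d"
proof -
  have "(1::real) \<le> real k ^ 2" using assms by simp
  then have "4 \<le> sqrt (real d)" "4 * real k ^ 2 + 1 \<le> 2 * sqrt (real d)"
    using assms by linarith+
  then have "4 * real k ^ 2 + 1 \<le> sqrt (real d) * sqrt (real d)"
    using mult_right_mono[of 2 "sqrt (real d)" "sqrt (real d)"] by linarith
  then have "real (4 * k\<^sup>2 + 1) \<le> real d" by simp
  then show ?thesis by (simp only: of_nat_le_iff)
qed

text \<open>With v = \<open>card V\<close>, the fraction of such \<open>S\<close> is at most (v
  choose k) (s choose k) / (d choose k) <= (v/d)^k (3s/k)^k. Both sides are multiplied by (d k)^k to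
  avoid divisions.\<close>

lemma card_large_intersection_power_le:
  assumes k: "k \<ge> 1" "4 * real k ^ 2 \<le> sqrt (real d)"
    and V: "V \<subseteq> {..<d}" "real (card V) \<le> 4 * sqrt (real d)"
  defines "s \<equiv> 4 * k\<^sup>2 + 1"
  shows "real (card {S. S \<subseteq> {..<d} \<and> card S = s \<and> k \<le> card (V \<inter> S)})
    \<le> real (d choose s) * (60 * real k / sqrt (real d)) ^ k"
proof -
  define v where "v = card V"
  have k1: "(1::real) \<le> real k ^ 2" using k by simp
  then have "0 < sqrt (real d)" using k by linarith
  then have d0: "0 < real d" by simp
  have vd: "v \<le> d" using V card_mono[of "{..<d}" V] by (simp add: v_def)
  have ks: "k \<le> s" by (simp add: s_def power2_eq_square le_SucI trans_le_add1)
  have sd: "s \<le> d" unfolding s_def by (rule block_size_le[OF k])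
  have fact_bound: "real (s choose k) * real k ^ k \<le> (3 * real s) ^ k"
  proof -
    have "real (s choose k) * real k ^ k \<le> real (s choose k) * (3 ^ k * fact k)"
      by (intro mult_left_mono power_self_le_fact) auto
    also have "\<dots> = 3 ^ k * real ((s choose k) * fact k)" by simp
    also have "\<dots> \<le> 3 ^ k * real (s ^ k)"
      using binomial_fact_pow[of s k] by (intro mult_left_mono) (simp_all only: of_nat_le_iff, simp)
    finally show ?thesis by (simp add: power_mult_distrib)
  qed
  have base: "real v * (3 * real s) \<le> (60 * real k / sqrt (real d)) * (real d * real k)"
  proof -
    have "real v * (3 * real s) \<le> (4 * sqrt (real d)) * (3 * (5 * real k ^ 2))"
      using V k1 by (intro mult_mono) (auto simp: v_def s_def)
    also have "\<dots> = (60 * real k / sqrt (real d)) * ((sqrt (real d) * sqrt (real d)) * real k)"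
      using d0 by (simp add: field_simps power2_eq_square del: real_sqrt_mult_self)
    finally show ?thesis by simp
  qed
  have "real (card {S. S \<subseteq> {..<d} \<and> card S = s \<and> k \<le> card (V \<inter> S)}) * (real d * real k) ^ k
      \<le> real ((v choose k) * ((d - k) choose (s - k))) * (real d * real k) ^ k"
    using card_large_intersection_le[OF _ V(1), of s k]
    by (intro mult_right_mono) (simp_all only: of_nat_le_iff v_def, simp_all)
  also have "\<dots> = real ((v choose k) * d ^ k) * (real ((d - k) choose (s - k)) * real k ^ k)"
    by (simp add: power_mult_distrib)
  also have "\<dots> \<le> real ((d choose k) * v ^ k) * (real ((d - k) choose (s - k)) * real k ^ k)"
    using choose_times_power_mono[OF vd, of k] by (intro mult_right_mono) (simp_all only: of_nat_le_iff, simp)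
  also have "\<dots> = real ((d choose k) * ((d - k) choose (s - k))) * (real v ^ k * real k ^ k)"
    by simp
  also have "(d choose k) * ((d - k) choose (s - k)) = (d choose s) * (s choose k)"
    using choose_mult[OF ks sd] by simp
  also have "real ((d choose s) * (s choose k)) * (real v ^ k * real k ^ k)
      = real (d choose s) * (real v ^ k * (real (s choose k) * real k ^ k))"
    by simp
  also have "\<dots> \<le> real (d choose s) * (real v ^ k * (3 * real s) ^ k)"
    using fact_bound by (intro mult_left_mono) auto
  also have "\<dots> \<le> real (d choose s) * ((60 * real k / sqrt (real d)) * (real d * real k)) ^ k"
    unfolding power_mult_distrib[symmetric] using base by (intro mult_left_mono power_mono) auto
  also have "\<dots> = (real (d choose s) * (60 * real k / sqrt (real d)) ^ k) * (real d * real k) ^ k"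
    by (simp only: power_mult_distrib mult.assoc)
  finally show ?thesis
    using d0 k by (simp only: mult_le_cancel_right_pos zero_less_power mult_pos_pos of_nat_0_less_iff)
qed

lemma sum_prob_le:
  fixes T :: "'a pmf"
  assumes "finite F" and "\<And>p. p \<in> set_pmf T \<Longrightarrow> real (card {S \<in> F. P S p}) \<le> B"
  shows "(\<Sum>S\<in>F. measure_pmf.prob T {p. P S p}) \<le> B"
proof -
  have int: "integrable (measure_pmf T) (indicator {p. P S p} :: _ \<Rightarrow> real)" for S
    by (intro measure_pmf.integrable_const_bound[where B = 1]) auto
  have "(\<Sum>S\<in>F. measure_pmf.prob T {p. P S p})
      = (\<Sum>S\<in>F. \<integral>p. indicator {p. P S p} p \<partial>measure_pmf T)"
    by simp
  also have "\<dots> = (\<integral>p. (\<Sum>S\<in>F. indicator {p. P S p} p) \<partial>measure_pmf T)"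
    using int by (simp only: Bochner_Integration.integral_sum)
  also have "\<dots> = (\<integral>p. real (card {S \<in> F. P S p}) \<partial>measure_pmf T)"
    using assms(1) by (intro Bochner_Integration.integral_cong refl)
      (simp add: indicator_def Int_def flip: sum.inter_filter)
  also have "\<dots> \<le> B"
  proof (rule measure_pmf.integral_le_const)
    show "integrable (measure_pmf T) (\<lambda>p. real (card {S \<in> F. P S p}))"
      using assms(1) by (intro measure_pmf.integrable_const_bound[where B = "real (card F)"])
        (auto intro!: card_mono)
  qed (use assms(2) in \<open>auto simp: AE_measure_pmf_iff\<close>)
  finally show ?thesis .
qed

lemma query_lower_bound:
  assumes k: "k \<ge> 1" "4 * real k ^ 2 \<le> sqrt (real d)"
    and T: "one_sided_na_tester d k (1 / 8) q T"
  shows "2 / 3 \<le> real q ^ 2 * (60 * real k / sqrt (real d)) ^ k"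
proof -
  define s where "s = 4 * k\<^sup>2 + 1"
  define F where "F = {S. S \<subseteq> {..<d} \<and> card S = s}"
  define M where "M = real (d choose s) * (60 * real k / sqrt (real d)) ^ k"
  have M0: "0 \<le> M" by (simp add: M_def)
  have finF: "finite F" by (simp add: F_def)
  have cF: "card F = d choose s" using n_subsets[of "{..<d}" s] by (simp add: F_def)
  have k1: "(1::real) \<le> real k ^ 2" using k by simp
  then have "0 < sqrt (real d)" using k by linarith
  then have d1: "d \<ge> 1" by simp
  have sd: "s \<le> d" unfolding s_def by (rule block_size_le[OF k])
  have few: "real (card {S \<in> F. separates d k (set (fst p)) S}) \<le> real q ^ 2 * M"
    if p: "p \<in> set_pmf T" for p
  proof -
    let ?Q = "set (fst p)"
    have Q: "length (fst p) \<le> q" "?Q \<subseteq> cube d"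
      using T p unfolding one_sided_na_tester_def by (cases p; fastforce)+
    define R where "R = {(x, y) \<in> ?Q \<times> ?Q. x \<subseteq> y \<and> middle d x \<and> middle d y}"
    have "R \<subseteq> ?Q \<times> ?Q" by (auto simp: R_def)
    then have finR: "finite R" and R_le: "card R \<le> card ?Q * card ?Q"
      using finite_subset[of R "?Q \<times> ?Q"] card_mono[of "?Q \<times> ?Q" R]
      by (auto simp: card_cartesian_product)
    note R_le
    also have "\<dots> \<le> q * q"
      using card_length[of "fst p"] Q(1) by (intro mult_mono) auto
    finally have cR: "real (card R) \<le> real q ^ 2"
      by (metis of_nat_le_iff of_nat_mult power2_eq_square)
    let ?G = "\<lambda>e. {S. S \<subseteq> {..<d} \<and> card S = s \<and> k \<le> card ((snd e - fst e) \<inter> S)}"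
    have "{S \<in> F. separates d k ?Q S} \<subseteq> (\<Union>e\<in>R. ?G e)"
      by (force simp: F_def separates_def R_def)
    then have "card {S \<in> F. separates d k ?Q S} \<le> card (\<Union>e\<in>R. ?G e)"
      using finR by (intro card_mono) auto
    also have "\<dots> \<le> (\<Sum>e\<in>R. card (?G e))"
      by (rule card_UN_le[OF finR])
    finally have "real (card {S \<in> F. separates d k ?Q S}) \<le> (\<Sum>e\<in>R. real (card (?G e)))"
      unfolding of_nat_sum[symmetric] of_nat_le_iff .
    also have "\<dots> \<le> (\<Sum>e\<in>R. M)"
    proof (rule sum_mono)
      fix e assume "e \<in> R"
      then obtain x y where e: "e = (x, y)" "x \<in> ?Q" "y \<in> ?Q" "x \<subseteq> y" "middle d x" "middle d y"
        by (auto simp: R_def)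
      then have "y \<subseteq> {..<d}" using Q(2) by (auto simp: cube_def)
      then have "y - x \<subseteq> {..<d}" "real (card (y - x)) \<le> 4 * sqrt (real d)"
        using middle_card_Diff_le[of y x d] finite_subset[of y "{..<d}"] e by auto
      from card_large_intersection_power_le[OF k this]
      show "real (card (?G e)) \<le> M" by (simp add: e(1) M_def s_def)
    qed
    also have "\<dots> \<le> real q ^ 2 * M" using cR M0 by (simp add: mult_right_mono)
    finally show ?thesis .
  qed
  have reject: "2 / 3 \<le> measure_pmf.prob T {p. separates d k (set (fst p)) S}" if S: "S \<in> F" for S
  proof -
    let ?f = "truncated_parity d k S"
    let ?Acc = "{(Q, D). D (map ?f Q)}"
    have "eps_far d k (1 / 8) ?f"
      using S by (intro eps_far_truncated_parity d1) (auto simp: F_def s_def)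
    then have "measure_pmf.prob T ?Acc \<le> 1 / 3"
      using T by (simp add: one_sided_na_tester_def accept_prob_def)
    then have "2 / 3 \<le> measure_pmf.prob T (- ?Acc)"
      using measure_pmf.prob_compl[of ?Acc T] by (simp add: Compl_eq_Diff_UNIV)
    also have "\<dots> \<le> measure_pmf.prob T {p. separates d k (set (fst p)) S}"
    proof (rule measure_pmf.finite_measure_mono_AE)
      have "separates d k (set Q) S" if QD: "(Q, D) \<in> set_pmf T" "\<not> D (map ?f Q)" for Q D
      proof -
        have "set Q \<subseteq> cube d" using T QD(1) by (auto simp: one_sided_na_tester_def)
        then show ?thesis
          using rejection_imp_alternating_chain[OF T QD] alternating_chain_truncated_parity by blast
      qed
      then show "AE p in measure_pmf T. p \<in> - ?Acc \<longrightarrow> p \<in> {p. separates d k (set (fst p)) S}"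
        by (auto simp: AE_measure_pmf_iff)
    qed simp
    finally show ?thesis .
  qed
  have "real (d choose s) * (2 / 3) = (\<Sum>S\<in>F. 2 / 3)" by (simp add: cF)
  also have "\<dots> \<le> (\<Sum>S\<in>F. measure_pmf.prob T {p. separates d k (set (fst p)) S})"
    by (intro sum_mono reject)
  also have "\<dots> \<le> real q ^ 2 * M"
    by (intro sum_prob_le finF few)
  also have "\<dots> = real (d choose s) * (real q ^ 2 * (60 * real k / sqrt (real d)) ^ k)"
    by (simp add: M_def)
  finally show ?thesis
    using sd by (simp only: mult_le_cancel_left_pos of_nat_0_less_iff zero_less_binomial_iff)
qed

theorem theorem1p1:
  "\<exists>eps > 0. \<exists>c > 0. \<forall>d k q T.
     d \<ge> 1 \<longrightarrow> 1 \<le> k \<longrightarrow> real k \<le> real d powr (1/4) / 2 \<longrightarrow>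
     one_sided_na_tester d k eps q T \<longrightarrow>
     real q \<ge> (c * real d / real k ^ 2) powr (real k / 4)"
proof (rule exI[of _ "1 / 8"], rule conjI, simp, rule exI[of _ "1 / 8100"], intro conjI allI impI)
  fix d k q T
  assume d: "d \<ge> 1" and k: "1 \<le> k" "real k \<le> real d powr (1/4) / 2"
    and T: "one_sided_na_tester d k (1 / 8) q T"
  have "(2 * real k)\<^sup>2 \<le> (real d powr (1/4))\<^sup>2"
    using k by (intro power_mono) auto
  also have "\<dots> = sqrt (real d)"
    using d by (simp add: power2_eq_square powr_half_sqrt flip: powr_add)
  finally have kd: "4 * real k ^ 2 \<le> sqrt (real d)" by (simp add: power_mult_distrib)
  define u where "u = sqrt (real d) / (90 * real k)"
  have u0: "u > 0" using d k by (simp add: u_def)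
  have "2 / 3 * u ^ k \<le> (real q ^ 2 * (60 * real k / sqrt (real d)) ^ k) * u ^ k"
    using u0 by (intro mult_right_mono query_lower_bound[OF k(1) kd T]) auto
  also have "\<dots> = real q ^ 2 * (60 * real k / sqrt (real d) * u) ^ k"
    by (simp only: power_mult_distrib mult.assoc)
  also have "60 * real k / sqrt (real d) * u = 2 / 3"
    using d k by (simp add: u_def)
  also have "real q ^ 2 * (2 / 3) ^ k \<le> real q ^ 2 * (2 / 3)"
    using k(1) power_decreasing[of 1 k "2 / 3 :: real"] by (intro mult_left_mono) auto
  finally have uq: "u ^ k \<le> real q ^ 2" by simp
  have eq: "1 / 8100 * real d / real k ^ 2 = u powr 2"
    using d u0 by (simp add: u_def power_divide power_mult_distrib)
  have "((1 / 8100 * real d / real k ^ 2) powr (real k / 4))\<^sup>2 = (u powr (2 * (real k / 4)))\<^sup>2"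
    by (simp only: eq powr_powr)
  also have "\<dots> = u powr real k"
    by (simp add: power2_eq_square flip: powr_add)
  also have "\<dots> \<le> real q ^ 2" using uq u0 by (simp add: powr_realpow)
  finally show "real q \<ge> (1 / 8100 * real d / real k ^ 2) powr (real k / 4)"
    by (rule power2_le_imp_le) simp
qed auto

end
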